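(* Let $\mathcal{P}$ be a graded locally branched finite lattice given as a meet semi-sublattice of the boolean lattice $B_n$. Let $m$ be the number of coatoms of $\mathcal{P}$, let $n$ be the number of atoms, let $\alpha$ be the sum of the cardinalities of the coatoms (viewed as subsets of $\{1,\dots,n\}$), and let $\varphi=|\mathcal{P}|$. Suppose each level set of $\mathcal{P}$ (with respect to the grading) is given as a list whose elements are represented as sorted lists of atoms. Then all cover relations of $\mathcal{P}$ can be generated in time $\mathcal{O}(\alpha\cdot\min(m,n)\cdot\varphi)$ in the cost model described in the context.
   Context: A finite lattice is locally branched if for every saturated chain $a\prec b\prec c$ there is an element $d\neq b$ with $a<d<c$. It is graded if there is a rank function $\rho:\mathcal{P}\to\mathbb{Z}$ with $p\prec q\Rightarrow \rho(p)+1=\rho(q)$; the level sets are the fibers of $\rho$. $B_n$ is the lattice of all subsets of $\{1,\dots,n\}$ ordered by inclusion. That $\mathcal{P}$ is given as a meet semi-sublattice of $B_n$ means: the atoms of $\mathcal{P}$ are $\{1\},\dots,\{n\}$ (identified with $1,\dots,n$), each element is identified with the set of atoms below it, the order is inclusion, and meets are intersections. Coatoms are the lower covers of the upper bound. Cost model. Sets are stored as sorted lists of their elements. For sets $A,B$ of lengths $a,b$ and a (possibly unsorted) list $D$ of $k$ sets of total length $\beta$: finding (and possibly deleting) a given element in $D$ takes time $\mathcal{O}(\beta)$; deleting all duplicates in $D$ takes time $\mathcal{O}(\beta\cdot k)$; computing $A\cap B$ or $A\cup B$ takes time $\mathcal{O}(\max(a,b))$; a subset check $A\subseteq B$ takes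 time $\mathcal{O}(b)$; checking whether $A$ is a subset of any element of $D$ takes time $\mathcal{O}(\beta)$; a list of $\varphi$ sets each of length at most $n$ can be sorted in time $\mathcal{O}(n\cdot\varphi\cdot\log\varphi)$; and a set with $a$ elements can be looked up in a sorted list of $\varphi$ sets in time $\mathcal{O}(a\cdot\log\varphi)$. *)

theory Defs
  imports Complex_Main "HOL-Algebra.Lattice" "HOL-Library.List_Lexorder"
begin

section \<open>Lattices of subsets of \<open>{1..n}\<close>\<close>

definition inclusion_order :: "'a set set \<Rightarrow> 'a set gorder" where
  "inclusion_order P = \<lparr>carrier = P, eq = (=), le = (\<subseteq>)\<rparr>"

definition covers :: "'a set set \<Rightarrow> 'a set \<Rightarrow> 'a set \<Rightarrow> bool" where
  "covers P A B \<longleftrightarrow> A \<in> P \<and> B \<in> P \<and> A \<subset> B \<and> \<not> (\<exists>D\<in>P. A \<subset> D \<and> D \<subset> B)"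

definition atoms :: "'a set set \<Rightarrow> 'a set set" where
  "atoms P = {A. covers P \<bottom>\<^bsub>inclusion_order P\<^esub> A}"

definition coatoms :: "'a set set \<Rightarrow> 'a set set" where
  "coatoms P = {A. covers P A \<top>\<^bsub>inclusion_order P\<^esub>}"

text \<open>Only meets are required to agree with those of the boolean lattice; joins are taken in
  \<open>P\<close> and may be strictly larger than unions.  As the atoms are the singletons, an element of \<open>P\<close>
  automatically is the set of atoms below it.\<close>

definition meet_subsemilattice :: "nat \<Rightarrow> nat set set \<Rightarrow> bool" where
  "meet_subsemilattice n P \<longleftrightarrow>
     P \<subseteq> Pow {1..n} \<and> P \<noteq> {} \<and> Lattice.lattice (inclusion_order P) \<and>
     (\<forall>A\<in>P. \<forall>B\<in>P. A \<sqinter>\<^bsub>inclusion_order P\<^esub> B = A \<inter> B) \<and>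
     atoms P = (\<lambda>i. {i}) ` {1..n}"

definition locally_branched :: "'a set set \<Rightarrow> bool" where
  "locally_branched P \<longleftrightarrow>
     (\<forall>A B C. covers P A B \<and> covers P B C \<longrightarrow> (\<exists>D\<in>P. D \<noteq> B \<and> A \<subset> D \<and> D \<subset> C))"

definition rank_function :: "'a set set \<Rightarrow> ('a set \<Rightarrow> int) \<Rightarrow> bool" where
  "rank_function P \<rho> \<longleftrightarrow> (\<forall>A B. covers P A B \<longrightarrow> \<rho> A + 1 = \<rho> B)"

text \<open>\<open>Ls\<close> lists the fibres of \<open>\<rho>\<close> by increasing rank.  Each fibre is listed in an arbitrary order,
  without repetition.\<close>

definition level_lists ::
  "nat set set \<Rightarrow> (nat set \<Rightarrow> int) \<Rightarrow> nat list list list \<Rightarrow> bool" where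
  "level_lists P \<rho> Ls \<longleftrightarrow>
     (\<exists>r. \<rho> ` P = {r..<r + int (length Ls)} \<and>
       (\<forall>i<length Ls. distinct (Ls ! i) \<and>
          set (Ls ! i) = sorted_list_of_set ` {A\<in>P. \<rho> A = r + int i}))"


section \<open>The cost model\<close>

text \<open>Programs of a first-order imperative language manipulate values that can be inspected
  only through the operations below.  The type \<open>prog\<close> embeds no HOL functions: a program is a finite
  object that is chosen independently of the input.

  Values are immutable and shared, so assigning one to a variable takes constant time.  Sets are
  sorted lists, \<open>FamV\<close> is a list of sets and \<open>LevV\<close> is a list of lists of sets.  Numbers also serve
  as truth values, with \<open>0\<close> for false.\<close>

datatype val = NumV nat | SetV "nat list" | FamV "nat list list" | LevV "nat list list list"

datatype operation =
    ConstN nat | SuccN | EqN | Move | NilF | ConsF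
  | MemberF | DeleteF | DedupF | Isect | Unite | SubsetS | SubsetF | SortF | LookupF

text \<open>Sorted lists of sets are sorted lexicographically.  Searching a list that is not sorted is an
  error.  A successful search yields the successor of a position, a failed one yields \<open>0\<close>.\<close>

definition position :: "'a \<Rightarrow> 'a list \<Rightarrow> nat" where
  "position x xs = (if x \<in> set xs then Suc (LEAST i. i < length xs \<and> xs ! i = x) else 0)"

primrec result :: "operation \<Rightarrow> val list \<Rightarrow> val option" where
  "result (ConstN k) vs = (case vs of [] \<Rightarrow> Some (NumV k) | _ \<Rightarrow> None)"
| "result SuccN vs = (case vs of [NumV k] \<Rightarrow> Some (NumV (Suc k)) | _ \<Rightarrow> None)"
| "result EqN vs =
     (case vs of [NumV j, NumV k] \<Rightarrow> Some (NumV (of_bool (j = k))) | _ \<Rightarrow> None)"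
| "result Move vs = (case vs of [v] \<Rightarrow> Some v | _ \<Rightarrow> None)"
| "result NilF vs = (case vs of [] \<Rightarrow> Some (FamV []) | _ \<Rightarrow> None)"
| "result ConsF vs =
     (case vs of [SetV A, FamV D] \<Rightarrow> Some (FamV (A # D)) | _ \<Rightarrow> None)"
| "result MemberF vs =
     (case vs of [SetV A, FamV D] \<Rightarrow> Some (NumV (of_bool (A \<in> set D))) | _ \<Rightarrow> None)"
| "result DeleteF vs =
     (case vs of [SetV A, FamV D] \<Rightarrow> Some (FamV (remove1 A D)) | _ \<Rightarrow> None)"
| "result DedupF vs =
     (case vs of [FamV D] \<Rightarrow> Some (FamV (remdups D)) | _ \<Rightarrow> None)"
| "result Isect vs =
     (case vs of [SetV A, SetV B] \<Rightarrow> Some (SetV (sorted_list_of_set (set A \<inter> set B))) | _ \<Rightarrow> None)"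
| "result Unite vs =
     (case vs of [SetV A, SetV B] \<Rightarrow> Some (SetV (sorted_list_of_set (set A \<union> set B))) | _ \<Rightarrow> None)"
| "result SubsetS vs =
     (case vs of [SetV A, SetV B] \<Rightarrow> Some (NumV (of_bool (set A \<subseteq> set B))) | _ \<Rightarrow> None)"
| "result SubsetF vs =
     (case vs of [SetV A, FamV D] \<Rightarrow> Some (NumV (of_bool (\<exists>B\<in>set D. set A \<subseteq> set B))) | _ \<Rightarrow> None)"
| "result SortF vs =
     (case vs of [FamV D] \<Rightarrow> Some (FamV (sort D)) | _ \<Rightarrow> None)"
| "result LookupF vs =
     (case vs of
        [SetV A, FamV D] \<Rightarrow> (if sorted D then Some (NumV (position A D)) else None)
      | _ \<Rightarrow> None)"

text \<open>To keep empty sets, empty lists and lists with a single member from being processed for free,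
  every size parameter of a bound is increased by one, and \<open>log \<phi>\<close> is replaced by
  \<open>log (2 + \<phi>)\<close>.\<close>

definition set_size :: "nat list \<Rightarrow> real" where
  "set_size A = 1 + real (length A)"

definition fam_size :: "nat list list \<Rightarrow> real" where
  "fam_size D = 1 + (\<Sum>A\<leftarrow>D. set_size A)"

definition max_size :: "nat list list \<Rightarrow> real" where
  "max_size D = Max (insert 1 (set_size ` set D))"

definition lg :: "nat \<Rightarrow> real" where
  "lg k = log 2 (2 + real k)"

primrec time_bound :: "operation \<Rightarrow> val list \<Rightarrow> real" where
  "time_bound (ConstN k) vs = 1"
| "time_bound SuccN vs = 1"
| "time_bound EqN vs = 1"
| "time_bound Move vs = 1"
| "time_bound NilF vs = 1"
| "time_bound ConsF vs = 1"
| "time_bound MemberF vs =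
     (case vs of [SetV A, FamV D] \<Rightarrow> fam_size D | _ \<Rightarrow> 1)"
| "time_bound DeleteF vs =
     (case vs of [SetV A, FamV D] \<Rightarrow> fam_size D | _ \<Rightarrow> 1)"
| "time_bound DedupF vs =
     (case vs of [FamV D] \<Rightarrow> fam_size D * (1 + real (length D)) | _ \<Rightarrow> 1)"
| "time_bound Isect vs =
     (case vs of [SetV A, SetV B] \<Rightarrow> max (set_size A) (set_size B) | _ \<Rightarrow> 1)"
| "time_bound Unite vs =
     (case vs of [SetV A, SetV B] \<Rightarrow> max (set_size A) (set_size B) | _ \<Rightarrow> 1)"
| "time_bound SubsetS vs =
     (case vs of [SetV A, SetV B] \<Rightarrow> set_size B | _ \<Rightarrow> 1)"
| "time_bound SubsetF vs =
     (case vs of [SetV A, FamV D] \<Rightarrow> fam_size D | _ \<Rightarrow> 1)"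
| "time_bound SortF vs =
     (case vs of [FamV D] \<Rightarrow> max_size D * (1 + real (length D)) * lg (length D) | _ \<Rightarrow> 1)"
| "time_bound LookupF vs =
     (case vs of [SetV A, FamV D] \<Rightarrow> set_size A * lg (length D) | _ \<Rightarrow> 1)"

text \<open>\<open>T f vs\<close> is the time taken by operation \<open>f\<close> on the arguments \<open>vs\<close>.\<close>

definition cost_model :: "(operation \<Rightarrow> val list \<Rightarrow> real) \<Rightarrow> bool" where
  "cost_model T \<longleftrightarrow> (\<exists>K. \<forall>f vs. 0 \<le> T f vs \<and> T f vs \<le> K * time_bound f vs)"


section \<open>Programs\<close>

datatype prog =
    Skip
  | Assign nat operation "nat list"
  | Load nat nat
  | Store nat nat
  | Emit nat nat
  | Seq prog prog
  | Cond nat prog prog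
  | ForEach nat nat prog

text \<open>Besides variables there is a random access memory of numbers, initially zero, and an output
  list to which pairs of sets are added.\<close>

record state =
  vars :: "nat \<Rightarrow> val"
  mem :: "nat \<Rightarrow> nat"
  out :: "(nat list \<times> nat list) list"
  time :: real

definition tick :: "real \<Rightarrow> state \<Rightarrow> state" where
  "tick t s = s\<lparr>time := time s + t\<rparr>"

definition set_var :: "nat \<Rightarrow> val \<Rightarrow> state \<Rightarrow> state" where
  "set_var x v s = s\<lparr>vars := (vars s)(x := v)\<rparr>"

fun items :: "val \<Rightarrow> val list option" where
  "items (FamV D) = Some (map SetV D)"
| "items (LevV L) = Some (map FamV L)"
| "items _ = None"

text \<open>Emitting a pair of sets takes time proportional to the sizes of the sets; it is assumed that
  they are copied to the output.  \<open>Load x y\<close> sets \<open>x\<close> to the contents of the memory cell with address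
  \<open>y\<close>, \<open>Store x y\<close> writes \<open>y\<close> to the cell with address \<open>x\<close>, and \<open>ForEach x y c\<close> runs \<open>c\<close> with \<open>x\<close>
  ranging over the members of the list that is initially held by \<open>y\<close>.\<close>

primrec exec :: "(operation \<Rightarrow> val list \<Rightarrow> real) \<Rightarrow> prog \<Rightarrow> state \<Rightarrow> state option" where
  "exec T Skip s = Some s"
| "exec T (Assign x f ys) s =
     (let vs = map (vars s) ys in
      map_option (\<lambda>v. tick (1 + T f vs) (set_var x v s)) (result f vs))"
| "exec T (Load x y) s =
     (case vars s y of
        NumV a \<Rightarrow> Some (tick 1 (set_var x (NumV (mem s a)) s))
      | _ \<Rightarrow> None)"
| "exec T (Store x y) s =
     (case (vars s x, vars s y) of
        (NumV a, NumV k) \<Rightarrow> Some (tick 1 (s\<lparr>mem := (mem s)(a := k)\<rparr>))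
      | _ \<Rightarrow> None)"
| "exec T (Emit x y) s =
     (case (vars s x, vars s y) of
        (SetV A, SetV B) \<Rightarrow>
          Some (tick (set_size A + set_size B) (s\<lparr>out := (A, B) # out s\<rparr>))
      | _ \<Rightarrow> None)"
| "exec T (Seq c d) s = Option.bind (exec T c s) (exec T d)"
| "exec T (Cond x c d) s =
     (case vars s x of
        NumV k \<Rightarrow> (if k \<noteq> 0 then exec T c (tick 1 s) else exec T d (tick 1 s))
      | _ \<Rightarrow> None)"
| "exec T (ForEach x y c) s =
     Option.bind (items (vars s y))
       (\<lambda>vs. fold (\<lambda>v r. Option.bind r (\<lambda>s'. exec T c (tick 1 (set_var x v s'))))
          vs (Some (tick 1 s)))"

definition initial_state :: "nat list list list \<Rightarrow> state" where
  "initial_state Ls =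
     \<lparr>vars = (\<lambda>_. NumV 0)(0 := LevV Ls), mem = (\<lambda>_. 0), out = [], time = 0\<rparr>"

definition generates_covers :: "nat set set \<Rightarrow> state \<Rightarrow> bool" where
  "generates_covers P s \<longleftrightarrow> distinct (out s) \<and>
     set (out s) = {(sorted_list_of_set A, sorted_list_of_set B) |A B. covers P A B}"

end

theory Submission
  imports Defs
begin

text \<open>If \<open>A\<close> is covered by \<open>B\<close>, then local branching yields a coatom \<open>C\<close> above \<open>A\<close> but not above
  \<open>B\<close>, so that \<open>A = B \<inter> C\<close>.  Hence the lower covers of \<open>B\<close> are exactly the intersections of \<open>B\<close>
  with coatoms that lie in the level below \<open>B\<close>.  For each \<open>B\<close>, the program forms all these
  intersections, looks them up in the sorted level below, and uses one memory cell per position to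
  recognise those found before.  Since \<open>P\<close> embeds both into the subsets of the atoms and into the
  subsets of the coatoms, the logarithmic factor in the cost of sorting and searching is
  \<open>O(min(m, n))\<close>.\<close>

section \<open>Graded locally branched lattices\<close>

locale graded_branched =
  fixes n :: nat and P :: "nat set set" and \<rho> :: "nat set \<Rightarrow> int"
  assumes msl: "meet_subsemilattice n P"
    and branched: "locally_branched P"
    and graded: "rank_function P \<rho>"
begin

section \<open>Meets, joins and the top element\<close>

definition top_elem :: "nat set" where
  "top_elem = \<top>\<^bsub>inclusion_order P\<^esub>"

lemma P_subset: "P \<subseteq> Pow {1..n}"
  and P_nonempty: "P \<noteq> {}"
  and lattice_P: "Lattice.lattice (inclusion_order P)"
  and singleton_in_P: "i \<in> {1..n} \<Longrightarrow> {i} \<in> P"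
proof -
  show "P \<subseteq> Pow {1..n}" "P \<noteq> {}" "Lattice.lattice (inclusion_order P)"
    using msl by (simp_all add: meet_subsemilattice_def)
  assume "i \<in> {1..n}"
  then have "{i} \<in> atoms P"
    using msl by (simp add: meet_subsemilattice_def)
  then show "{i} \<in> P"
    by (simp add: atoms_def covers_def)
qed

lemma finite_P: "finite P"
  by (rule finite_subset[OF P_subset]) simp

lemma finite_elem: "A \<in> P \<Longrightarrow> finite A"
  using P_subset finite_subset by blast

lemma Int_in_P:
  assumes "A \<in> P" "B \<in> P"
  shows "A \<inter> B \<in> P"
proof -
  interpret Lattice.lattice "inclusion_order P" by (rule lattice_P)
  have "A \<sqinter>\<^bsub>inclusion_order P\<^esub> B \<in> P"
    using meet_closed[of A B] assms by (simp add: inclusion_order_def)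
  then show ?thesis
    using msl assms by (simp add: meet_subsemilattice_def)
qed

text \<open>The union of \<open>A\<close> and \<open>B\<close> may lie outside \<open>P\<close>. The
  join enters \<open>coatoms_above_inj\<close> only through this universal property.\<close>

lemma join_exists:
  assumes "A \<in> P" "B \<in> P"
  shows "\<exists>J\<in>P. A \<subseteq> J \<and> B \<subseteq> J \<and> (\<forall>D\<in>P. A \<subseteq> D \<and> B \<subseteq> D \<longrightarrow> J \<subseteq> D)"
proof -
  interpret Lattice.lattice "inclusion_order P" by (rule lattice_P)
  show ?thesis
  proof (intro bexI[of _ "A \<squnion>\<^bsub>inclusion_order P\<^esub> B"] conjI ballI impI; (elim conjE)?)
    show "A \<squnion>\<^bsub>inclusion_order P\<^esub> B \<in> P"
      using join_closed[of A B] assms by (simp add: inclusion_order_def)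
    show "A \<subseteq> A \<squnion>\<^bsub>inclusion_order P\<^esub> B" "B \<subseteq> A \<squnion>\<^bsub>inclusion_order P\<^esub> B"
      using join_left[of A B] join_right[of A B] assms by (simp_all add: inclusion_order_def)
    show "A \<squnion>\<^bsub>inclusion_order P\<^esub> B \<subseteq> D" if "D \<in> P" "A \<subseteq> D" "B \<subseteq> D" for D
      using join_le[of A D B] assms that by (simp add: inclusion_order_def)
  qed
qed

lemma top_elem_in_P: "top_elem \<in> P"
  and le_top_elem: "A \<in> P \<Longrightarrow> A \<subseteq> top_elem"
proof -
  interpret Lattice.lattice "inclusion_order P" by (rule lattice_P)
  \<comment> \<open>\<open>\<top>\<close> is a Hilbert choice of a greatest element, so one has to
    be exhibited: the supremum of the finite nonempty set \<open>P\<close>.\<close>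
  have "least (inclusion_order P) (\<Squnion>\<^bsub>inclusion_order P\<^esub> P) (Upper (inclusion_order P) P)"
    using finite_sup_least[of P] finite_P P_nonempty by (simp add: inclusion_order_def)
  then have "greatest (inclusion_order P) (\<Squnion>\<^bsub>inclusion_order P\<^esub> P) P"
    by (auto simp: least_def greatest_def Upper_def inclusion_order_def)
  then have "\<exists>x. greatest (inclusion_order P) x (carrier (inclusion_order P))"
    by (auto simp: inclusion_order_def)
  then have "greatest (inclusion_order P) top_elem (carrier (inclusion_order P))"
    unfolding top_elem_def Order.top_def by (rule someI_ex)
  then show "top_elem \<in> P" "A \<in> P \<Longrightarrow> A \<subseteq> top_elem"
    by (auto simp: greatest_def inclusion_order_def)
qed

lemma coatoms_eq: "coatoms P = {A. covers P A top_elem}"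
  by (simp add: coatoms_def top_elem_def)

lemma coatom_in_P: "C \<in> coatoms P \<Longrightarrow> C \<in> P"
  by (simp add: coatoms_eq covers_def)

lemma finite_coatoms: "finite (coatoms P)"
  by (rule finite_subset[OF _ finite_P]) (auto dest: coatom_in_P)

section \<open>Existence of covers in intervals\<close>

lemma upper_cover_exists:
  assumes "A \<in> P" "B \<in> P" "A \<subset> B"
  shows "\<exists>D. covers P A D \<and> D \<subseteq> B"
proof -
  have "finite {D\<in>P. A \<subset> D \<and> D \<subseteq> B}" "{D\<in>P. A \<subset> D \<and> D \<subseteq> B} \<noteq> {}"
    using finite_P assms by auto
  from finite_has_minimal[OF this]
  obtain D where mem: "D \<in> {D\<in>P. A \<subset> D \<and> D \<subseteq> B}"
    and min: "\<forall>E\<in>{D\<in>P. A \<subset> D \<and> D \<subseteq> B}. E \<subseteq> D \<longrightarrow> D = E"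
    by (rule bexE)
  have D: "D \<in> P" "A \<subset> D" "D \<subseteq> B" using mem by simp_all
  have False if "E \<in> P" "A \<subset> E" "E \<subset> D" for E
    using that D min[rule_format, of E] by auto
  then have "covers P A D"
    using D assms(1) unfolding covers_def by blast
  then show ?thesis using D by blast
qed

lemma lower_cover_exists:
  assumes "A \<in> P" "B \<in> P" "A \<subset> B"
  shows "\<exists>D. covers P D B \<and> A \<subseteq> D"
proof -
  have "finite {D\<in>P. A \<subseteq> D \<and> D \<subset> B}" "{D\<in>P. A \<subseteq> D \<and> D \<subset> B} \<noteq> {}"
    using finite_P assms by auto
  from finite_has_maximal[OF this]
  obtain D where mem: "D \<in> {D\<in>P. A \<subseteq> D \<and> D \<subset> B}"
    and max: "\<forall>E\<in>{D\<in>P. A \<subseteq> D \<and> D \<subset> B}. D \<subseteq> E \<longrightarrow> D = E"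
    by (rule bexE)
  have D: "D \<in> P" "A \<subseteq> D" "D \<subset> B" using mem by simp_all
  have False if "E \<in> P" "D \<subset> E" "E \<subset> B" for E
    using that D max[rule_format, of E] by auto
  then have "covers P D B"
    using D assms(2) unfolding covers_def by blast
  then show ?thesis using D by blast
qed

lemma below_coatom:
  assumes "A \<in> P" "A \<noteq> top_elem"
  shows "\<exists>C\<in>coatoms P. A \<subseteq> C"
proof -
  have "A \<subset> top_elem" using assms le_top_elem by blast
  then show ?thesis
    using lower_cover_exists[of A top_elem] assms top_elem_in_P coatoms_eq by auto
qed

section \<open>Ranks and covers\<close>

lemma covers_rank: "covers P A B \<Longrightarrow> \<rho> B = \<rho> A + 1"
  using graded by (simp add: rank_function_def)

lemma covers_between: "covers P A B \<Longrightarrow> D \<in> P \<Longrightarrow> A \<subseteq> D \<Longrightarrow> D \<subset> B \<Longrightarrow> D = A"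
  unfolding covers_def by (metis psubsetI)

text \<open>Replacing \<open>A\<close> by a cover of it below \<open>B\<close> raises the rank by
  one and shrinks \<open>B - A\<close>, so the induction climbs to \<open>B\<close> along
  covers.\<close>

lemma rank_strict_mono:
  assumes "A \<in> P" "B \<in> P" "A \<subset> B"
  shows "\<rho> A < \<rho> B"
  using assms
proof (induction "card (B - A)" arbitrary: A rule: less_induct)
  case less
  obtain D where D: "covers P A D" "D \<subseteq> B"
    using upper_cover_exists less.prems by metis
  then have "D \<in> P" "A \<subset> D" and \<rho>: "\<rho> A + 1 = \<rho> D"
    using covers_rank[OF D(1)] by (simp_all add: covers_def)
  show ?case
  proof (cases "D = B")
    case False
    have "card (B - D) < card (B - A)"
      using finite_elem \<open>B \<in> P\<close> \<open>A \<subset> D\<close> \<open>D \<subseteq> B\<close> by (intro psubset_card_mono) auto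
    then have "\<rho> D < \<rho> B" using less.hyps[of D] False D \<open>D \<in> P\<close> \<open>B \<in> P\<close> by auto
    then show ?thesis using \<rho> by simp
  qed (use \<rho> in simp)
qed

text \<open>Ranks are integers and strictly monotone, so an element strictly between
  \<open>A\<close> and \<open>B\<close> would force a rank difference of at least two.\<close>

lemma covers_iff_rank:
  assumes "A \<in> P" "B \<in> P"
  shows "covers P A B \<longleftrightarrow> A \<subset> B \<and> \<rho> B = \<rho> A + 1"
proof
  assume "covers P A B"
  then show "A \<subset> B \<and> \<rho> B = \<rho> A + 1"
    using covers_rank by (simp add: covers_def)
next
  assume r: "A \<subset> B \<and> \<rho> B = \<rho> A + 1"
  have "\<not> (A \<subset> D \<and> D \<subset> B)" if "D \<in> P" for D
  proof
    assume "A \<subset> D \<and> D \<subset> B"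
    then have "\<rho> A < \<rho> D" "\<rho> D < \<rho> B"
      using rank_strict_mono[of A D] rank_strict_mono[of D B] assms that by simp_all
    then show False using r by simp
  qed
  then show "covers P A B" using r assms by (auto simp: covers_def)
qed

lemma rank_le_top: "A \<in> P \<Longrightarrow> \<rho> A \<le> \<rho> top_elem"
  using rank_strict_mono[of A top_elem] le_top_elem[of A] top_elem_in_P by force

section \<open>Coatoms and the covers they detect\<close>

lemma coatoms_eq_rank: "coatoms P = {A\<in>P. \<rho> A = \<rho> top_elem - 1}"
proof -
  have "covers P A top_elem \<longleftrightarrow> \<rho> A = \<rho> top_elem - 1" if "A \<in> P" for A
  proof -
    have "A \<subset> top_elem" if "\<rho> A = \<rho> top_elem - 1"
    proof -
      have "A \<noteq> top_elem" using that by auto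
      then show ?thesis using le_top_elem[OF \<open>A \<in> P\<close>] by auto
    qed
    then show ?thesis
      using covers_iff_rank[OF that top_elem_in_P] by auto
  qed
  moreover have "A \<in> P" if "covers P A top_elem" for A
    using that by (simp add: covers_def)
  ultimately show ?thesis
    unfolding coatoms_eq by (intro Collect_cong) metis
qed

text \<open>If \<open>B\<close> is the top, \<open>A\<close> itself is the coatom. Otherwise let
  \<open>U\<close> cover \<open>B\<close>; branching gives \<open>D\<close> beside \<open>B\<close>
  between \<open>A\<close> and \<open>U\<close>, of the same rank as \<open>B\<close>, so
  \<open>U\<close> covers \<open>D\<close> and induction yields a coatom \<open>C\<close> above
  \<open>D\<close> but not above \<open>U\<close>. If \<open>C\<close> contained \<open>B\<close>,
  then \<open>U \<inter> C\<close> would lie between \<open>B\<close> and \<open>U\<close> without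
  being \<open>U\<close>, hence equal \<open>B\<close>; but it contains \<open>D\<close>, so
  \<open>D\<close> would lie strictly below an element of its own rank.\<close>

lemma covers_separated_by_coatom:
  assumes "covers P A B"
  shows "\<exists>C\<in>coatoms P. A \<subseteq> C \<and> \<not> B \<subseteq> C"
  using assms
proof (induction "card (top_elem - A)" arbitrary: A B rule: less_induct)
  case less
  have AB: "A \<in> P" "B \<in> P" "A \<subset> B" "\<rho> B = \<rho> A + 1"
    using less.prems covers_rank[OF less.prems] by (simp_all add: covers_def)
  show ?case
  proof (cases "B = top_elem")
    case True
    then show ?thesis using less.prems AB by (auto simp: coatoms_eq)
  next
    case False
    obtain U where U: "covers P B U"
      using upper_cover_exists[of B top_elem] False AB top_elem_in_P le_top_elem[of B] by auto
    then have "U \<in> P" "B \<subset> U" "\<rho> U = \<rho> B + 1"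
      using covers_rank[OF U] by (simp_all add: covers_def)
    obtain D where D: "D \<in> P" "D \<noteq> B" "A \<subset> D" "D \<subset> U"
      using branched[unfolded locally_branched_def, rule_format, of A B U] less.prems U by auto
    have "\<rho> A < \<rho> D" "\<rho> D < \<rho> U"
      using rank_strict_mono[of A D] rank_strict_mono[of D U] D \<open>A \<in> P\<close> \<open>U \<in> P\<close> by simp_all
    then have \<rho>D: "\<rho> D = \<rho> B" using AB \<open>\<rho> U = \<rho> B + 1\<close> by simp
    then have DU: "covers P D U"
      using covers_iff_rank D \<open>U \<in> P\<close> \<open>\<rho> U = \<rho> B + 1\<close> by simp
    have "card (top_elem - D) < card (top_elem - A)"
      using finite_elem[OF top_elem_in_P] D(3) le_top_elem[OF D(1)]
      by (intro psubset_card_mono) auto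
    then obtain C where C: "C \<in> coatoms P" "D \<subseteq> C" "\<not> U \<subseteq> C"
      using less.hyps[OF _ DU] by auto
    have "\<not> B \<subseteq> C"
    proof
      assume "B \<subseteq> C"
      then have "B \<subseteq> U \<inter> C" "U \<inter> C \<subset> U" "U \<inter> C \<in> P"
        using C Int_in_P coatom_in_P \<open>U \<in> P\<close> \<open>B \<subset> U\<close> by auto
      then have "U \<inter> C = B" using covers_between[OF U] by metis
      then have "D \<subset> B" using D C by auto
      then show False using rank_strict_mono[of D B] D(1) AB(2) \<rho>D by simp
    qed
    then show ?thesis using C(1,2) D(3) by (intro bexI[of _ C]) auto
  qed
qed

text \<open>The rank hypothesis acts as a filter: \<open>B \<inter> C\<close> may also be
  \<open>B\<close> itself or lie several ranks below \<open>B\<close>.\<close>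

lemma covers_iff_coatom:
  assumes "A \<in> P" "B \<in> P" "\<rho> B = \<rho> A + 1"
  shows "covers P A B \<longleftrightarrow> (\<exists>C\<in>coatoms P. A = B \<inter> C)"
proof
  assume cov: "covers P A B"
  then obtain C where C: "C \<in> coatoms P" "A \<subseteq> C" "\<not> B \<subseteq> C"
    using covers_separated_by_coatom by metis
  then have "A \<subseteq> B \<inter> C" "B \<inter> C \<subset> B" "B \<inter> C \<in> P"
    using cov Int_in_P coatom_in_P assms by (auto simp: covers_def)
  then have "A = B \<inter> C" using covers_between[OF cov] by metis
  then show "\<exists>C\<in>coatoms P. A = B \<inter> C" using C(1) by auto
next
  assume "\<exists>C\<in>coatoms P. A = B \<inter> C"
  then have "A \<subseteq> B" by auto
  moreover have "A \<noteq> B" using assms by auto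
  ultimately show "covers P A B" using covers_iff_rank assms by auto
qed

text \<open>An element is determined by the coatoms above it. If all coatoms above \<open>A\<close>
  lie above \<open>B\<close> but \<open>B\<close> is not below \<open>A\<close>, then the join
  \<open>J\<close> is strictly above \<open>A\<close> and some cover \<open>D\<close> of
  \<open>A\<close> lies below \<open>J\<close>. A coatom separating \<open>A\<close> from
  \<open>D\<close> contains \<open>A\<close> and \<open>B\<close>, hence \<open>J\<close>, hence
  \<open>D\<close>, a contradiction.\<close>

lemma coatoms_above_inj: "inj_on (\<lambda>A. {C\<in>coatoms P. A \<subseteq> C}) P"
proof (rule inj_onI)
  have sub: "B \<subseteq> A"
    if AB: "A \<in> P" "B \<in> P" and le: "{C\<in>coatoms P. A \<subseteq> C} \<subseteq> {C\<in>coatoms P. B \<subseteq> C}" for A B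
  proof (rule ccontr)
    assume "\<not> B \<subseteq> A"
    obtain J where J: "J \<in> P" "A \<subseteq> J" "B \<subseteq> J"
      "\<forall>D\<in>P. A \<subseteq> D \<and> B \<subseteq> D \<longrightarrow> J \<subseteq> D"
      using join_exists[OF AB] by metis
    have "A \<subset> J" using J(2,3) \<open>\<not> B \<subseteq> A\<close> by auto
    then obtain D where "covers P A D" "D \<subseteq> J"
      using upper_cover_exists J(1) \<open>A \<in> P\<close> by metis
    then obtain C where C: "C \<in> coatoms P" "A \<subseteq> C" "\<not> D \<subseteq> C"
      using covers_separated_by_coatom by metis
    have "B \<subseteq> C" using le C by auto
    then have "J \<subseteq> C" using J(4) C coatom_in_P by simp
    then show False using C \<open>D \<subseteq> J\<close> by auto
  qed
  fix A B assume "A \<in> P" "B \<in> P" "{C\<in>coatoms P. A \<subseteq> C} = {C\<in>coatoms P. B \<subseteq> C}"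
  then show "A = B" using sub[of A B] sub[of B A] by auto
qed

section \<open>Size bounds in terms of atoms and coatoms\<close>

lemma card_P_le: "card P \<le> 2 ^ min (card (coatoms P)) n"
proof -
  have "card P = card ((\<lambda>A. {C\<in>coatoms P. A \<subseteq> C}) ` P)"
    using coatoms_above_inj by (simp add: card_image)
  also have "\<dots> \<le> card (Pow (coatoms P))"
    using finite_coatoms by (intro card_mono) auto
  finally have "card P \<le> 2 ^ card (coatoms P)"
    using finite_coatoms by (simp add: card_Pow)
  moreover have "card P \<le> 2 ^ n"
    using card_mono[OF _ P_subset] by (simp add: card_Pow)
  ultimately show ?thesis by (simp add: min_def)
qed

abbreviation alpha :: nat where
  "alpha \<equiv> \<Sum>A\<in>coatoms P. card A"

text \<open>Here every coatom is empty, and every element other than the top lies below a coatom, so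
  only the empty set and the top remain. This is the degenerate case in which the product in the
  time bound vanishes.\<close>

lemma small_if_alpha_zero:
  assumes "alpha = 0"
  shows "card P \<le> 2" "card (coatoms P) \<le> 1" "n \<le> 1"
proof -
  have C: "C = {}" if "C \<in> coatoms P" for C
    using that assms finite_coatoms finite_elem[OF coatom_in_P[OF that]] by (metis card_0_eq sum_eq_0_iff)
  then have "coatoms P \<subseteq> {{}}" by auto
  from card_mono[OF _ this] show "card (coatoms P) \<le> 1" by simp
  have "P \<subseteq> {{}, top_elem}"
  proof
    fix A assume "A \<in> P"
    then show "A \<in> {{}, top_elem}"
      using below_coatom[of A] C by (cases "A = top_elem") auto
  qed
  from card_mono[OF _ this] have "card P \<le> card {{}, top_elem}" by simp
  also have "\<dots> \<le> 2" by (simp add: card_insert_if)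
  finally show "card P \<le> 2" .
  \<comment> \<open>The singletons are nonempty elements of \<open>P\<close>, so each equals the
    top; hence there is at most one.\<close>
  have "{1..n} \<subseteq> {x. {x} = top_elem}"
    using singleton_in_P \<open>P \<subseteq> {{}, top_elem}\<close> by fastforce
  then have "x = y" if "x \<in> {1..n}" "y \<in> {1..n}" for x y
    using that by (metis (mono_tags) mem_Collect_eq singleton_inject subsetD)
  from this[of 1 2] show "n \<le> 1" by (cases "n \<le> 1") auto
qed

text \<open>Each coatom is nonempty and so contributes at least \<open>1\<close> to
  \<open>alpha\<close>, and the coatoms together contain every atom.\<close>

lemma sizes_le_alpha:
  assumes "alpha \<noteq> 0"
  shows "card (coatoms P) \<le> alpha" "n \<le> alpha"
proof -
  have "{} \<notin> coatoms P"
  proof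
    assume e: "{} \<in> coatoms P"
    \<comment> \<open>Every coatom contains the coatom \<open>{}\<close> and is strictly below the
      top, so it equals \<open>{}\<close>.\<close>
    have "C = {}" if "C \<in> coatoms P" for C
      using that covers_between[of "{}" top_elem C] e by (auto simp: coatoms_eq covers_def)
    then have "alpha = 0" by (intro sum.neutral ballI) (metis card.empty)
      then show False using assms by simp
  qed
  then have pos: "card C \<ge> 1" if "C \<in> coatoms P" for C
    using that finite_elem[OF coatom_in_P[OF that]] by (metis One_nat_def Suc_leI card_gt_0_iff)
  show "card (coatoms P) \<le> alpha"
    using sum_mono[of "coatoms P" "\<lambda>_. 1" card] pos by simp
  have "{1..n} \<subseteq> \<Union>(coatoms P)"
  proof
    fix i assume i: "i \<in> {1..n}"
    have "{i} \<noteq> top_elem"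
    proof
      assume i: "{i} = top_elem"
      have "C = {}" if "C \<in> coatoms P" for C
      proof -
        have "C \<subset> top_elem" using that by (simp add: coatoms_eq covers_def)
        then show ?thesis unfolding i[symmetric] by auto
      qed
      then have "alpha = 0" by (intro sum.neutral ballI) (metis card.empty)
      then show False using assms by simp
    qed
    then show "i \<in> \<Union>(coatoms P)" using below_coatom[OF singleton_in_P[OF i]] by auto
  qed
  then have "card {1..n} \<le> card (\<Union>(coatoms P))"
    using finite_coatoms coatom_in_P finite_elem by (intro card_mono) auto
  also have "\<dots> \<le> alpha" by (rule card_Union_le_sum_card)
  finally show "n \<le> alpha" by simp
qed

end


section \<open>The program and its running time\<close>

text \<open>Invariant rule for loops. \<open>I\<close> is indexed by the members processed so far,
  and \<open>f\<close> is the constructor that \<open>items\<close> wraps around a member.\<close>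

lemma exec_ForEach:
  assumes items: "items (vars s y) = Some (map f xs)"
    and init: "I [] (tick 1 s)"
    and step: "\<And>us v ws s'. xs = us @ v # ws \<Longrightarrow> I us s' \<Longrightarrow>
      \<exists>s''. exec T c (tick 1 (set_var x (f v) s')) = Some s'' \<and> I (us @ [v]) s''"
  shows "\<exists>s'. exec T (ForEach x y c) s = Some s' \<and> I xs s'"
proof -
  let ?g = "\<lambda>v r. Option.bind r (\<lambda>s'. exec T c (tick 1 (set_var x v s')))"
  have "\<exists>s'. fold ?g (map f us) (Some (tick 1 s)) = Some s' \<and> I us s'"
    if "xs = us @ ws" for us ws
    using that
  proof (induction us arbitrary: ws rule: rev_induct)
    case Nil
    then show ?case using init by simp
  next
    case (snoc v us)
    then obtain s' where "fold ?g (map f us) (Some (tick 1 s)) = Some s'" "I us s'"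
      by force
    then show ?case using step[of us v ws s'] snoc.prems by simp
  qed
  from this[of xs "[]"] show ?thesis using items by simp
qed

section \<open>Positions and intersections of sorted lists\<close>

lemma position_eq_0_iff: "position x xs = 0 \<longleftrightarrow> x \<notin> set xs"
  by (simp add: position_def)

lemma position_inj:
  assumes "position x xs = position y xs" "position x xs \<noteq> 0"
  shows "x = y"
proof -
  \<comment> \<open>Positions are counted from one, so the entry is found at the preceding
    index.\<close>
  have nth: "xs ! (position z xs - 1) = z" if "z \<in> set xs" for z
  proof -
    have "\<exists>i. i < length xs \<and> xs ! i = z" using that by (simp add: in_set_conv_nth)
    from LeastI_ex[OF this] show ?thesis using that by (simp add: position_def)
  qed
  have "x \<in> set xs" "y \<in> set xs" using assms by (metis position_eq_0_iff)+
  then show ?thesis using nth[of x] nth[of y] assms(1) by simp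
qed

definition meet_list :: "nat list \<Rightarrow> nat list \<Rightarrow> nat list" where
  "meet_list A C = sorted_list_of_set (set A \<inter> set C)"

lemma length_meet_list_le: "length (meet_list A C) \<le> length A" "length (meet_list A C) \<le> length C"
proof -
  have "card (set A \<inter> set C) \<le> card (set A)" "card (set A \<inter> set C) \<le> card (set C)"
    by (auto intro: card_mono)
  then show "length (meet_list A C) \<le> length A" "length (meet_list A C) \<le> length C"
    using card_length[of A] card_length[of C] by (simp_all add: meet_list_def)
qed

text \<open>Variables: 0 level lists, 1 current level, 2 coatoms (the last level but one), 3 last level,
  4 sorted previous level, 5 current element, 6 current coatom, 7 stamp, 8 intersection,
  9 position of the intersection in the previous level.  A memory cell containing the current stamp
  marks a position whose element has already been emitted for the current element.\<close>

definition try_coatom :: prog where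
  "try_coatom =
     Seq (Assign 8 Isect [5, 6])
    (Seq (Assign 9 LookupF [8, 4])
         (Cond 9
           (Seq (Load 10 9)
           (Seq (Assign 11 EqN [10, 7])
                (Cond 11 Skip (Seq (Store 9 7) (Emit 8 5)))))
           Skip))"

text \<open>Raising the stamp invalidates all marks left by earlier elements at once, so the memory
  is never cleared.\<close>

definition lower_covers :: prog where
  "lower_covers = Seq (Assign 7 SuccN [7]) (ForEach 6 2 try_coatom)"

text \<open>Sorting comes last: while a level is processed, variable 4 must still hold the sorted
  previous level; the new sorted list serves the next level.\<close>

definition process_level :: prog where
  "process_level = Seq (ForEach 5 1 lower_covers) (Assign 4 SortF [1])"

text \<open>Variable 2 trails variable 3 by one level, so at the end they hold the last level but
  one and the last level.\<close>

definition find_coatoms :: prog where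
  "find_coatoms =
     Seq (Assign 2 NilF [])
    (Seq (Assign 3 NilF [])
         (ForEach 1 0 (Seq (Assign 2 Move [3]) (Assign 3 Move [1]))))"

definition cover_relations :: prog where
  "cover_relations =
     Seq find_coatoms (Seq (Assign 4 NilF []) (ForEach 1 0 process_level))"

section \<open>Size measures and the sets of emitted pairs\<close>

lemma lg_ge_1: "1 \<le> lg k"
  by (simp add: lg_def le_log_iff)

lemma lg_mono: "j \<le> k \<Longrightarrow> lg j \<le> lg k"
  by (simp add: lg_def)

lemma set_size_ge_1: "1 \<le> set_size A"
  by (simp add: set_size_def)

text \<open>With \<open>Cs\<close> cut to a prefix, this describes the progress of the loop over the
  coatoms. The image identifies coatoms with equal intersections, which the program has to
  skip.\<close>

definition emitted :: "nat list list \<Rightarrow> nat list \<Rightarrow> nat list list \<Rightarrow> (nat list \<times> nat list) set" where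
  "emitted D A Cs = (\<lambda>B. (B, A)) ` (set D \<inter> meet_list A ` set Cs)"

lemma snd_emitted: "snd ` emitted D A Cs \<subseteq> {A}"
  by (auto simp: emitted_def)

lemma emitted_Nil [simp]: "emitted D A [] = {}"
  by (simp add: emitted_def)

definition emitted_levels :: "nat list list \<Rightarrow> nat list list list \<Rightarrow> (nat list \<times> nat list) set" where
  "emitted_levels Cs Ls =
     {(B, A). \<exists>i. Suc i < length Ls \<and> A \<in> set (Ls ! Suc i) \<and> (B, A) \<in> emitted (Ls ! i) A Cs}"

lemma emitted_levels_Nil [simp]: "emitted_levels Cs [] = {}"
  by (simp add: emitted_levels_def)

text \<open>The first level counts as preceded by an empty one, matching the initial content of
  variable 4.\<close>

lemma emitted_levels_snoc:
  "emitted_levels Cs (Ls @ [L]) = emitted_levels Cs Ls \<union>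
     (\<Union>A\<in>set L. emitted (if Ls = [] then [] else last Ls) A Cs)"
proof (cases Ls rule: rev_cases)
  case Nil
  then show ?thesis by (auto simp: emitted_levels_def emitted_def)
next
  case (snoc Ks K)
  have "(\<exists>i. Suc i < length (Ls @ [L]) \<and> Q i) \<longleftrightarrow>
      (\<exists>i. Suc i < length Ls \<and> Q i) \<or> Q (length Ks)" for Q
    using snoc by (auto simp: less_Suc_eq)
  then show ?thesis
    using snoc by (auto simp: emitted_levels_def nth_append emitted_def less_Suc_eq)
qed

lemma snd_emitted_levels: "snd ` emitted_levels Cs Ls \<subseteq> set (concat Ls)"
  unfolding emitted_levels_def by (auto intro!: nth_mem)

text \<open>The test matters because of truncated subtraction: for a single level, index
  \<open>length Ls - 2\<close> would select the level of the top.\<close>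

definition coatom_level :: "nat list list list \<Rightarrow> nat list list" where
  "coatom_level Ls = (if length Ls < 2 then [] else Ls ! (length Ls - 2))"

section \<open>Loop invariants and running time\<close>

locale bounded_cost =
  fixes T :: "operation \<Rightarrow> val list \<Rightarrow> real" and K :: real
  assumes K_ge_1: "1 \<le> K"
    and T_le: "T f vs \<le> K * time_bound f vs"
begin

text \<open>The cells holding the stamp \<open>k\<close> are exactly the positions of the
  intersections found so far; address \<open>0\<close> is excluded because it reports a failed
  search. The bound \<open>k\<close> on all cells makes the next stamp fresh.\<close>

definition coatom_inv :: "state \<Rightarrow> nat list list \<Rightarrow> nat list \<Rightarrow> nat \<Rightarrow> nat list list \<Rightarrow> state \<Rightarrow> bool" where
  "coatom_inv s0 D A k Cs s \<longleftrightarrow>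
     (\<forall>x<6. vars s x = vars s0 x) \<and> vars s 7 = NumV k \<and>
     (\<forall>a. mem s a \<le> k) \<and>
     (\<forall>a. mem s a = k \<longleftrightarrow> a \<noteq> 0 \<and> a \<in> (\<lambda>C. position (meet_list A C) D) ` set Cs) \<and>
     distinct (out s) \<and> set (out s) = set (out s0) \<union> emitted D A Cs \<and>
     time s \<le> time s0 + 1 + 11 * K * (\<Sum>C\<leftarrow>Cs. set_size A + set_size C * lg (length D))"

text \<open>\<open>new\<close> separates the pairs emitted for \<open>A\<close> from all earlier
  ones, so a repetition can only come from two coatoms with the same intersection, which the stamp
  detects.\<close>

lemma try_coatom_step:
  assumes inv: "coatom_inv s0 D A k Cs s"
    and vars: "vars s0 4 = FamV D" "vars s0 5 = SetV A"
    and D: "sorted D" and new: "A \<notin> snd ` set (out s0)"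
  shows "\<exists>s'. exec T try_coatom (tick 1 (set_var 6 (SetV C) s)) = Some s' \<and>
           coatom_inv s0 D A k (Cs @ [C]) s'"
proof -
  have v: "vars s 4 = FamV D" "vars s 5 = SetV A" "vars s 7 = NumV k"
    using inv vars by (simp_all add: coatom_inv_def)
  have mem: "mem s a \<le> k" "mem s a = k \<longleftrightarrow> a \<noteq> 0 \<and> a \<in> (\<lambda>C. position (meet_list A C) D) ` set Cs" for a
    using inv by (simp_all add: coatom_inv_def)
  let ?B = "meet_list A C"
  let ?p = "position ?B D"
  let ?b = "set_size A + set_size C * lg (length D)"
  have sizes: "set_size ?B \<le> set_size A" "set_size ?B \<le> set_size C"
    using length_meet_list_le by (simp_all add: set_size_def)
  have b1: "1 \<le> set_size C * lg (length D)"
    using mult_mono[OF set_size_ge_1[of C] lg_ge_1[of "length D"]] set_size_ge_1[of C] by simp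
  have bC: "set_size C \<le> set_size C * lg (length D)"
    using mult_left_mono[OF lg_ge_1[of "length D"], of "set_size C"] set_size_ge_1[of C] by simp
  have Kb: "?b \<le> K * ?b" "2 \<le> ?b" "K * 2 \<le> K * ?b"
    using K_ge_1 b1 set_size_ge_1[of A] mult_right_mono[OF K_ge_1, of ?b] mult_left_mono[of 2 ?b K]
    by simp_all
  have t1: "T Isect [SetV A, SetV C] \<le> K * ?b"
  proof -
    have "T Isect [SetV A, SetV C] \<le> K * max (set_size A) (set_size C)"
      using T_le[of Isect "[SetV A, SetV C]"] by simp
    also have "\<dots> \<le> K * ?b"
    proof (rule mult_left_mono)
      show "max (set_size A) (set_size C) \<le> ?b"
        using b1 bC set_size_ge_1[of A] by linarith
    qed (use K_ge_1 in simp)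
    finally show ?thesis .
  qed
  have t2: "T LookupF [SetV ?B, FamV D] \<le> K * ?b"
  proof -
    have "T LookupF [SetV ?B, FamV D] \<le> K * (set_size ?B * lg (length D))"
      using T_le[of LookupF "[SetV ?B, FamV D]"] by simp
    also have "\<dots> \<le> K * (set_size C * lg (length D))"
      using K_ge_1 sizes lg_ge_1[of "length D"] by (intro mult_left_mono mult_right_mono) auto
    also have "\<dots> \<le> K * ?b"
      using K_ge_1 set_size_ge_1[of A] by (intro mult_left_mono) auto
    finally show ?thesis .
  qed
  have t3: "T EqN vs \<le> K" for vs
    using T_le[of EqN vs] by simp
  show ?thesis
  \<comment> \<open>The first case is exactly the one in which a pair is emitted.\<close>
  proof (cases "?B \<in> set D \<and> mem s ?p \<noteq> k")
    case True
    then have p: "?p \<noteq> 0" by (simp add: position_eq_0_iff)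
    have fresh: "?B \<notin> meet_list A ` set Cs"
      using True p mem(2)[of ?p] by auto
    have fresh: "(?B, A) \<notin> set (out s)"
    proof -
      have "(?B, A) \<notin> set (out s0)" using new by (metis snd_conv image_eqI)
      moreover have "(?B, A) \<notin> emitted D A Cs" using fresh unfolding emitted_def by auto
      ultimately show ?thesis using inv by (simp add: coatom_inv_def)
    qed
    have "\<exists>s'. exec T try_coatom (tick 1 (set_var 6 (SetV C) s)) = Some s' \<and>
        (\<forall>x<6. vars s' x = vars s x) \<and> vars s' 7 = NumV k \<and>
        mem s' = (mem s)(?p := k) \<and> out s' = (?B, A) # out s \<and>
        time s' = time s + T Isect [SetV A, SetV C] + T LookupF [SetV ?B, FamV D] +
          T EqN [NumV (mem s ?p), NumV k] + set_size ?B + set_size A + 8"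
      using v D p True
      by (simp add: try_coatom_def tick_def set_var_def meet_list_def[symmetric])
    then obtain s' where s': "exec T try_coatom (tick 1 (set_var 6 (SetV C) s)) = Some s'"
        "\<forall>x<6. vars s' x = vars s x" "vars s' 7 = NumV k"
        "mem s' = (mem s)(?p := k)" "out s' = (?B, A) # out s"
        "time s' = time s + T Isect [SetV A, SetV C] + T LookupF [SetV ?B, FamV D] +
          T EqN [NumV (mem s ?p), NumV k] + set_size ?B + set_size A + 8"
      by blast
    \<comment> \<open>The eight unit steps cost at most \<open>4 * (K * ?b)\<close> because
      \<open>?b\<close> is at least \<open>2\<close>; the two set operations, the comparison and the
      emission fit into \<open>4 * (K * ?b)\<close> as well.\<close>
    have "time s' \<le> time s + 11 * (K * ?b)"
      using s'(6) t1 t2 t3[of "[NumV (mem s ?p), NumV k]"] Kb sizes K_ge_1 bC by linarith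
    moreover have "emitted D A (Cs @ [C]) = insert (?B, A) (emitted D A Cs)"
      using True by (auto simp: emitted_def)
    moreover have "mem s' a = k \<longleftrightarrow>
        a \<noteq> 0 \<and> a \<in> (\<lambda>C. position (meet_list A C) D) ` set (Cs @ [C])" for a
      using mem(2)[of a] p s'(4) by auto
    moreover have "mem s' a \<le> k" for a
      using mem(1) s'(4) by simp
    ultimately have "coatom_inv s0 D A k (Cs @ [C]) s'"
      using inv s'(2,3,5) fresh unfolding coatom_inv_def by (simp add: distrib_left)
    then show ?thesis using s'(1) by blast
  next
    case False
    \<comment> \<open>The comparison runs only if the search succeeded; \<open>max 0\<close> bounds
      its cost in both subcases.\<close>
    have "\<exists>s'. exec T try_coatom (tick 1 (set_var 6 (SetV C) s)) = Some s' \<and>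
        (\<forall>x<6. vars s' x = vars s x) \<and> vars s' 7 = NumV k \<and>
        mem s' = mem s \<and> out s' = out s \<and>
        time s' \<le> time s + T Isect [SetV A, SetV C] + T LookupF [SetV ?B, FamV D] +
          max 0 (T EqN [NumV (mem s ?p), NumV k]) + 8"
      using v D False
      by (simp add: try_coatom_def tick_def set_var_def meet_list_def[symmetric] position_eq_0_iff max_def)
    then obtain s' where s': "exec T try_coatom (tick 1 (set_var 6 (SetV C) s)) = Some s'"
        "\<forall>x<6. vars s' x = vars s x" "vars s' 7 = NumV k"
        "mem s' = mem s" "out s' = out s"
        "time s' \<le> time s + T Isect [SetV A, SetV C] + T LookupF [SetV ?B, FamV D] +
          max 0 (T EqN [NumV (mem s ?p), NumV k]) + 8"
      by blast
    have "time s' \<le> time s + 11 * (K * ?b)"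
      using s'(6) t1 t2 t3[of "[NumV (mem s ?p), NumV k]"] Kb K_ge_1 by linarith
    \<comment> \<open>The mark comes from an earlier coatom whose intersection has the same nonzero
      position, hence is the same set.\<close>
    moreover have "?B \<in> meet_list A ` set Cs" if "?B \<in> set D"
    proof -
      have "?p \<noteq> 0" "?p \<in> (\<lambda>C. position (meet_list A C) D) ` set Cs"
        using that False mem(2)[of ?p] by simp_all
      then show ?thesis using position_inj[of ?B D] by auto
    qed
    then have "emitted D A (Cs @ [C]) = emitted D A Cs"
      by (auto simp: emitted_def)
    moreover have "mem s' a = k \<longleftrightarrow>
        a \<noteq> 0 \<and> a \<in> (\<lambda>C. position (meet_list A C) D) ` set (Cs @ [C])" for a
      using mem(2)[of a] mem(2)[of ?p] False s'(4) position_eq_0_iff[of ?B D]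
      by (cases "a = ?p") auto
    ultimately have "coatom_inv s0 D A k (Cs @ [C]) s'"
      using inv s'(2-5) unfolding coatom_inv_def by (simp add: distrib_left)
    then show ?thesis using s'(1) by blast
  qed
qed

text \<open>\<open>W\<close> bounds the work per element. The stamp changes with every element, so
  only its bounding all cells is recorded.\<close>

definition level_inv :: "state \<Rightarrow> nat list list \<Rightarrow> nat list list \<Rightarrow> real \<Rightarrow> nat list list \<Rightarrow> state \<Rightarrow> bool" where
  "level_inv s0 D Cs W As s \<longleftrightarrow>
     (\<forall>x<5. vars s x = vars s0 x) \<and> (\<exists>k. vars s 7 = NumV k \<and> (\<forall>a. mem s a \<le> k)) \<and>
     distinct (out s) \<and> set (out s) = set (out s0) \<union> (\<Union>A\<in>set As. emitted D A Cs) \<and>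
     time s \<le> time s0 + 1 + W * real (length As)"

lemma lower_covers_step:
  assumes inv: "level_inv s0 D Cs W As s"
    and vars: "vars s0 2 = FamV Cs" "vars s0 4 = FamV D"
    and D: "sorted D" and new: "A \<notin> snd ` set (out s0)" "A \<notin> set As"
    and W: "4 * K + 11 * K * (\<Sum>C\<leftarrow>Cs. set_size A + set_size C * lg (length D)) \<le> W"
  shows "\<exists>s'. exec T lower_covers (tick 1 (set_var 5 (SetV A) s)) = Some s' \<and>
           level_inv s0 D Cs W (As @ [A]) s'"
proof -
  obtain k where k: "vars s 7 = NumV k" "\<And>a. mem s a \<le> k"
    using inv unfolding level_inv_def by blast
  define s1 where "s1 = tick (1 + T SuccN [NumV k])
    (set_var 7 (NumV (Suc k)) (tick 1 (set_var 5 (SetV A) s)))"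
  have s1: "\<forall>x<5. vars s1 x = vars s0 x" "vars s1 5 = SetV A" "vars s1 7 = NumV (Suc k)"
    "mem s1 = mem s" "out s1 = out s" "time s1 = time s + 2 + T SuccN [NumV k]"
    using inv by (simp_all add: s1_def tick_def set_var_def level_inv_def)
  have "A \<notin> snd ` (\<Union>A\<in>set As. emitted D A Cs)"
    using snd_emitted[of D _ Cs] new(2) by blast
  then have new1: "A \<notin> snd ` set (out s1)"
    using inv new(1) s1(5) by (simp add: level_inv_def image_Un)
  \<comment> \<open>All cells are at most the old stamp, so none carries the new one.\<close>
  have "mem s1 a \<noteq> Suc k" "mem s1 a \<le> Suc k" for a
    using k(2)[of a] s1(4) by simp_all
  then have init: "coatom_inv s1 D A (Suc k) [] (tick 1 s1)"
    using s1 inv by (simp add: coatom_inv_def tick_def level_inv_def)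
  have "\<exists>s'. exec T (ForEach 6 2 try_coatom) s1 = Some s' \<and> coatom_inv s1 D A (Suc k) Cs s'"
  proof (rule exec_ForEach)
    show "items (vars s1 2) = Some (map SetV Cs)" using s1(1) vars by simp
    show "coatom_inv s1 D A (Suc k) [] (tick 1 s1)" by (rule init)
    show "\<exists>s''. exec T try_coatom (tick 1 (set_var 6 (SetV v) s')) = Some s'' \<and>
        coatom_inv s1 D A (Suc k) (us @ [v]) s''"
      if "coatom_inv s1 D A (Suc k) us s'" for us v s'
      using that s1 vars D new1 by (intro try_coatom_step) simp_all
  qed
  then obtain s' where s': "exec T (ForEach 6 2 try_coatom) s1 = Some s'"
      "coatom_inv s1 D A (Suc k) Cs s'"
    by blast
  have "exec T lower_covers (tick 1 (set_var 5 (SetV A) s)) = Some s'"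
    using k(1) s'(1) by (simp add: lower_covers_def s1_def tick_def set_var_def)
  moreover have "level_inv s0 D Cs W (As @ [A]) s'"
  proof -
    \<comment> \<open>The term \<open>4 * K\<close> in the bound on \<open>W\<close> pays for this
      operation and three unit steps.\<close>
    have "T SuccN [NumV k] \<le> K" using T_le[of SuccN "[NumV k]"] by simp
    then have "time s' \<le> time s + W"
      using s'(2) s1(6) W K_ge_1 by (simp add: coatom_inv_def)
    then show ?thesis
      using s'(2) s1 inv by (auto simp: level_inv_def coatom_inv_def distrib_left)
  qed
  ultimately show ?thesis by blast
qed

text \<open>Of the \<open>2 * W\<close> per element, one \<open>W\<close> is for finding its lower
  covers and the other for its share in sorting its level and in the overhead.\<close>

definition levels_inv :: "real \<Rightarrow> nat list list \<Rightarrow> real \<Rightarrow> nat list list list \<Rightarrow> state \<Rightarrow> bool" where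
  "levels_inv t Cs W Ls s \<longleftrightarrow>
     vars s 2 = FamV Cs \<and> vars s 4 = FamV (sort (if Ls = [] then [] else last Ls)) \<and>
     (\<exists>k. vars s 7 = NumV k \<and> (\<forall>a. mem s a \<le> k)) \<and>
     distinct (out s) \<and> set (out s) = emitted_levels Cs Ls \<and>
     time s \<le> t + 2 * W * real (length (concat Ls))"

lemma process_level_step:
  assumes inv: "levels_inv t Cs W Ls s"
    and disj: "distinct (concat (Ls @ [L]))" and "L \<noteq> []"
    and size: "\<And>A. A \<in> set L \<Longrightarrow> set_size A \<le> a"
    and len: "\<And>L'. L' \<in> set (Ls @ [L]) \<Longrightarrow> length L' \<le> N"
    and W1: "4 * K + 11 * K * (real (length Cs) * a + (\<Sum>C\<leftarrow>Cs. set_size C) * lg N) \<le> W"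
    and W2: "3 + 2 * K * a * lg N \<le> W"
  shows "\<exists>s'. exec T process_level (tick 1 (set_var 1 (FamV L) s)) = Some s' \<and>
           levels_inv t Cs W (Ls @ [L]) s'"
proof -
  let ?L0 = "if Ls = [] then [] else last Ls"
  let ?D = "sort ?L0"
  define s1 where "s1 = tick 1 (set_var 1 (FamV L) s)"
  have s1: "vars s1 1 = FamV L" "vars s1 2 = FamV Cs" "vars s1 4 = FamV ?D"
      "mem s1 = mem s" "vars s1 7 = vars s 7" "out s1 = out s" "time s1 = time s + 1"
    using inv by (simp_all add: s1_def tick_def set_var_def levels_inv_def)
  have a1: "1 \<le> a"
    using size[of "hd L"] \<open>L \<noteq> []\<close> set_size_ge_1[of "hd L"] by simp
  have lenD: "length ?D \<le> N" using len by simp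
  have "\<exists>s'. exec T (ForEach 5 1 lower_covers) s1 = Some s' \<and> level_inv s1 ?D Cs W L s'"
  proof (rule exec_ForEach)
    show "items (vars s1 1) = Some (map SetV L)" using s1 by simp
    show "level_inv s1 ?D Cs W [] (tick 1 s1)"
      using inv s1 by (simp add: level_inv_def levels_inv_def tick_def)
    fix us A ws s' assume L: "L = us @ A # ws" and inv': "level_inv s1 ?D Cs W us s'"
    have "A \<notin> set (concat Ls)" "A \<notin> set us" using disj L by auto
    have "A \<notin> snd ` set (out s1)"
      using \<open>A \<notin> set (concat Ls)\<close> snd_emitted_levels[of Cs Ls] inv s1(6) by (auto simp: levels_inv_def)
    have "(\<Sum>C\<leftarrow>Cs. set_size A + set_size C * lg (length ?D))
        \<le> (\<Sum>C\<leftarrow>Cs. a + set_size C * lg N)"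
    proof (rule sum_list_mono)
      fix C
      have "set_size C * lg (length ?D) \<le> set_size C * lg N"
        using lg_mono[OF lenD] set_size_ge_1[of C] by (intro mult_left_mono) auto
      then show "set_size A + set_size C * lg (length ?D) \<le> a + set_size C * lg N"
        using size[of A] L by simp
    qed
    also have "\<dots> = real (length Cs) * a + (\<Sum>C\<leftarrow>Cs. set_size C) * lg N"
      by (simp add: sum_list_addf sum_list_triv sum_list_mult_const)
    finally have "4 * K + 11 * K * (\<Sum>C\<leftarrow>Cs. set_size A + set_size C * lg (length ?D)) \<le> W"
      using W1 K_ge_1 mult_left_mono[of _ _ "11 * K"] by (smt (verit, best))
    then show "\<exists>s''. exec T lower_covers (tick 1 (set_var 5 (SetV A) s')) = Some s'' \<and>
        level_inv s1 ?D Cs W (us @ [A]) s''"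
      using inv' s1 \<open>A \<notin> set us\<close> \<open>A \<notin> snd ` set (out s1)\<close>
      by (intro lower_covers_step) simp_all
  qed
  then obtain s2 where s2: "exec T (ForEach 5 1 lower_covers) s1 = Some s2"
      "level_inv s1 ?D Cs W L s2"
    by blast
  have v1: "vars s2 1 = FamV L" "vars s2 2 = FamV Cs"
    using s2(2) s1 by (simp_all add: level_inv_def)
  define s3 where "s3 = tick (1 + T SortF [FamV L]) (set_var 4 (FamV (sort L)) s2)"
  have "exec T process_level (tick 1 (set_var 1 (FamV L) s)) = Some s3"
    using s2(1) v1 by (simp add: process_level_def s1_def s3_def)
  moreover have "levels_inv t Cs W (Ls @ [L]) s3"
  proof -
    have "max_size L \<le> a"
      using size a1 by (auto simp: max_size_def)
    moreover have "1 \<le> max_size L"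
      by (simp add: max_size_def)
    moreover have "lg (length L) \<le> lg N"
      using len by (intro lg_mono) simp
    \<comment> \<open>A nonempty level can charge its fixed costs to its members.\<close>
    moreover have "1 + real (length L) \<le> 2 * real (length L)"
      using \<open>L \<noteq> []\<close> by (cases L) auto
    ultimately have "max_size L * (1 + real (length L)) * lg (length L)
        \<le> a * (2 * real (length L)) * lg N"
      using lg_ge_1[of "length L"] a1 by (intro mult_mono) auto
    then have "K * (max_size L * (1 + real (length L)) * lg (length L))
        \<le> K * (a * (2 * real (length L)) * lg N)"
      using K_ge_1 by (intro mult_left_mono) auto
    then have "T SortF [FamV L] \<le> (2 * K * a * lg N) * real (length L)"
      using T_le[of SortF "[FamV L]"] by (simp add: algebra_simps)
    moreover have "3 \<le> 3 * real (length L)"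
      using \<open>L \<noteq> []\<close> by (cases L) auto
    moreover have "(3 + 2 * K * a * lg N) * real (length L) \<le> W * real (length L)"
      using W2 by (intro mult_right_mono) auto
    ultimately have "3 + T SortF [FamV L] \<le> W * real (length L)"
      by (simp add: distrib_right)
    then have "time s3 \<le> time s + 2 * W * real (length L)"
      using s2(2) s1(7) by (simp add: s3_def tick_def set_var_def level_inv_def)
    moreover have "(\<Union>A\<in>set L. emitted ?D A Cs) = (\<Union>A\<in>set L. emitted ?L0 A Cs)"
      by (simp add: emitted_def)
    ultimately show ?thesis
      using s2(2) s1 inv v1
      by (auto simp: levels_inv_def level_inv_def s3_def tick_def set_var_def emitted_levels_snoc
          distrib_left)
  qed
  ultimately show ?thesis by blast
qed

lemma process_levels:
  assumes s: "vars s 0 = LevV Ls" "vars s 2 = FamV Cs" "vars s 4 = FamV []" "vars s 7 = NumV 0"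
      "mem s = (\<lambda>_. 0)" "out s = []"
    and disj: "distinct (concat Ls)" and ne: "[] \<notin> set Ls"
    and size: "\<And>A. A \<in> set (concat Ls) \<Longrightarrow> set_size A \<le> a"
    and len: "\<And>L. L \<in> set Ls \<Longrightarrow> length L \<le> N"
    and W1: "4 * K + 11 * K * (real (length Cs) * a + (\<Sum>C\<leftarrow>Cs. set_size C) * lg N) \<le> W"
    and W2: "3 + 2 * K * a * lg N \<le> W"
  shows "\<exists>s'. exec T (ForEach 1 0 process_level) s = Some s' \<and> levels_inv (time s + 1) Cs W Ls s'"
proof (rule exec_ForEach)
  show "items (vars s 0) = Some (map FamV Ls)" using s by simp
  show "levels_inv (time s + 1) Cs W [] (tick 1 s)"
    using s by (simp add: levels_inv_def tick_def)
  fix us L ws s' assume "Ls = us @ L # ws" "levels_inv (time s + 1) Cs W us s'"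
  then show "\<exists>s''. exec T process_level (tick 1 (set_var 1 (FamV L) s')) = Some s'' \<and>
      levels_inv (time s + 1) Cs W (us @ [L]) s''"
    using disj ne size len W1 W2 by (intro process_level_step[where a = a and N = N]) auto
qed

lemma find_coatoms:
  "\<exists>s. exec T find_coatoms (initial_state Ls) = Some s \<and>
     vars s 0 = LevV Ls \<and> vars s 2 = FamV (coatom_level Ls) \<and> vars s 7 = NumV 0 \<and>
     mem s = (\<lambda>_. 0) \<and> out s = [] \<and> time s \<le> 5 * K + 5 * K * real (length Ls)"
proof -
  \<comment> \<open>The bound \<open>5 * K\<close> covers three unit steps and two operations, once
    for the initialisation and once per level.\<close>
  define I where "I us s \<longleftrightarrow>
     vars s 0 = LevV Ls \<and> vars s 2 = FamV (coatom_level us) \<and>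
     vars s 3 = FamV (if us = [] then [] else last us) \<and> vars s 7 = NumV 0 \<and>
     mem s = (\<lambda>_. 0) \<and> out s = [] \<and> time s \<le> 5 * K + 5 * K * real (length us)" for us and s :: state
  define s1 where "s1 = tick (1 + T NilF []) (set_var 3 (FamV []) (tick (1 + T NilF [])
    (set_var 2 (FamV []) (initial_state Ls))))"
  have T1: "T Move vs \<le> K" "T NilF vs \<le> K" for vs
    using T_le[of Move vs] T_le[of NilF vs] by simp_all
  have "\<exists>s. exec T (ForEach 1 0 (Seq (Assign 2 Move [3]) (Assign 3 Move [1]))) s1 = Some s \<and> I Ls s"
  proof (rule exec_ForEach)
    show "items (vars s1 0) = Some (map FamV Ls)"
      by (simp add: s1_def tick_def set_var_def initial_state_def)
    show "I [] (tick 1 s1)"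
      using T1(2)[of "[]"] K_ge_1
      by (simp add: I_def s1_def tick_def set_var_def initial_state_def coatom_level_def)
    fix us L ws s' assume I: "I us s'"
    have "coatom_level (us @ [L]) = (if us = [] then [] else last us)"
      by (cases us rule: rev_cases) (auto simp: coatom_level_def nth_append)
    then show "\<exists>s''. exec T (Seq (Assign 2 Move [3]) (Assign 3 Move [1]))
        (tick 1 (set_var 1 (FamV L) s')) = Some s'' \<and> I (us @ [L]) s''"
      using I T1(1)[of "[vars s' 3]"] T1(1)[of "[FamV L]"] K_ge_1
      by (simp add: I_def tick_def set_var_def distrib_left)
  qed
  moreover have "exec T find_coatoms (initial_state Ls) =
      exec T (ForEach 1 0 (Seq (Assign 2 Move [3]) (Assign 3 Move [1]))) s1"
    by (simp add: find_coatoms_def s1_def)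
  ultimately show ?thesis unfolding I_def by auto
qed

lemma cover_relations_correct:
  assumes disj: "distinct (concat Ls)" and ne: "[] \<notin> set Ls"
    and size: "\<And>A. A \<in> set (concat Ls) \<Longrightarrow> set_size A \<le> a"
    and len: "\<And>L. L \<in> set Ls \<Longrightarrow> length L \<le> N"
    and W1: "4 * K + 11 * K * (real (length (coatom_level Ls)) * a +
               (\<Sum>C\<leftarrow>coatom_level Ls. set_size C) * lg N) \<le> W"
    and W2: "3 + 2 * K * a * lg N \<le> W"
  shows "\<exists>s. exec T cover_relations (initial_state Ls) = Some s \<and> distinct (out s) \<and>
    set (out s) = emitted_levels (coatom_level Ls) Ls \<and>
    time s \<le> 8 * K + 5 * K * real (length Ls) + 2 * W * real (length (concat Ls))"
proof -
  obtain s1 where s1: "exec T find_coatoms (initial_state Ls) = Some s1"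
     "vars s1 0 = LevV Ls" "vars s1 2 = FamV (coatom_level Ls)" "vars s1 7 = NumV 0"
     "mem s1 = (\<lambda>_. 0)" "out s1 = []" "time s1 \<le> 5 * K + 5 * K * real (length Ls)"
    using find_coatoms by blast
  define s2 where "s2 = tick (1 + T NilF []) (set_var 4 (FamV []) s1)"
  have "\<exists>s. exec T (ForEach 1 0 process_level) s2 = Some s \<and>
      levels_inv (time s2 + 1) (coatom_level Ls) W Ls s"
    using s1 by (intro process_levels[OF _ _ _ _ _ _ disj ne size len W1 W2])
      (simp_all add: s2_def tick_def set_var_def)
  then obtain s where s: "exec T (ForEach 1 0 process_level) s2 = Some s"
      "levels_inv (time s2 + 1) (coatom_level Ls) W Ls s"
    by blast
  have "exec T cover_relations (initial_state Ls) = Some s"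
    using s1(1) s(1) by (simp add: cover_relations_def s2_def)
  moreover have "time s2 + 1 \<le> 8 * K + 5 * K * real (length Ls)"
    using s1(7) T_le[of NilF "[]"] K_ge_1 by (simp add: s2_def tick_def set_var_def)
  ultimately show ?thesis
    using s(2) by (auto simp: levels_inv_def)
qed

end


section \<open>Generating the cover relations\<close>

context graded_branched
begin

section \<open>Level lists of a graded lattice\<close>

context
  fixes Ls r
  assumes ranks: "\<rho> ` P = {r..<r + int (length Ls)}"
    and all_levels: "\<forall>i<length Ls. distinct (Ls ! i) \<and>
          set (Ls ! i) = sorted_list_of_set ` {A\<in>P. \<rho> A = r + int i}"
begin

lemmas levels = all_levels[rule_format]

lemma level_of:
  assumes "A \<in> P"
  shows "\<exists>i<length Ls. \<rho> A = r + int i"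
proof -
  have "\<rho> A \<in> {r..<r + int (length Ls)}" using ranks assms by auto
  then show ?thesis by (intro exI[of _ "nat (\<rho> A - r)"]) auto
qed

lemma inj_sorted_list: "inj_on sorted_list_of_set P"
  by (rule inj_onI) (metis finite_elem sorted_list_of_set.set_sorted_key_list_of_set)

lemma set_concat_levels: "set (concat Ls) = sorted_list_of_set ` P"
proof -
  have "set Ls = (!) Ls ` {..<length Ls}"
    by (auto simp: set_conv_nth)
  then have "set (concat Ls) = (\<Union>i<length Ls. set (Ls ! i))"
    by simp
  also have "\<dots> = (\<Union>i<length Ls. sorted_list_of_set ` {A\<in>P. \<rho> A = r + int i})"
    using levels by (intro SUP_cong) simp_all
  also have "\<dots> = sorted_list_of_set ` (\<Union>i<length Ls. {A\<in>P. \<rho> A = r + int i})"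
    by (simp add: image_UN)
  also have "(\<Union>i<length Ls. {A\<in>P. \<rho> A = r + int i}) = P"
    using level_of by auto
  finally show ?thesis .
qed

text \<open>The ranks fill an interval, so no level in between is skipped.\<close>

lemma level_nonempty: "i < length Ls \<Longrightarrow> Ls ! i \<noteq> []"
proof
  assume i: "i < length Ls" "Ls ! i = []"
  then have "r + int i \<in> \<rho> ` P" using ranks by simp
  then show False using levels[OF i(1)] i(2) by auto
qed

lemma levels_disjoint:
  assumes "i < length Ls" "j < length Ls" "i \<noteq> j"
  shows "set (Ls ! i) \<inter> set (Ls ! j) = {}"
proof -
  have "{A\<in>P. \<rho> A = r + int i} \<inter> {A\<in>P. \<rho> A = r + int j} = {}"
    using assms(3) by auto
  then have "sorted_list_of_set ` {A\<in>P. \<rho> A = r + int i} \<inter>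
      sorted_list_of_set ` {A\<in>P. \<rho> A = r + int j} = {}"
    using inj_on_image_Int[OF inj_sorted_list, of "{A\<in>P. \<rho> A = r + int i}" "{A\<in>P. \<rho> A = r + int j}"]
    by simp
  then show ?thesis using levels assms(1,2) by simp
qed

lemma distinct_concat_levels: "distinct (concat Ls)"
proof (rule distinct_concat)
  \<comment> \<open>Levels at different indices are disjoint, so equal ones would be empty.\<close>
  have "Ls ! i \<noteq> Ls ! j" if "i < length Ls" "j < length Ls" "i \<noteq> j" for i j
    using levels_disjoint[OF that] level_nonempty[OF that(1)] by auto
  then show "distinct Ls" by (simp add: distinct_conv_nth)
  show "distinct L" if "L \<in> set Ls" for L
    using that levels by (metis in_set_conv_nth)
  show "set L \<inter> set L' = {}" if "L \<in> set Ls" "L' \<in> set Ls" "L \<noteq> L'" for L L'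
    using that levels_disjoint by (metis in_set_conv_nth)
qed

lemma length_concat_levels: "length (concat Ls) = card P"
  using distinct_card[OF distinct_concat_levels] set_concat_levels
    card_image[OF inj_sorted_list] by simp

lemma length_level_le:
  assumes "L \<in> set Ls"
  shows "length L \<le> card P"
proof -
  have "length L \<le> sum_list (map length Ls)"
    using assms by (intro member_le_sum_list) auto
  then show ?thesis using length_concat_levels by (simp add: length_concat)
qed

lemma number_of_levels_le: "length Ls \<le> card P"
proof -
  have "length Ls = card (\<rho> ` P)" using ranks by simp
  also have "\<dots> \<le> card P" using finite_P by (rule card_image_le)
  finally show ?thesis .
qed

lemma rank_top: "\<rho> top_elem = r + int (length Ls) - 1"
proof -
  obtain i where i: "i < length Ls" "\<rho> top_elem = r + int i"
    using level_of[OF top_elem_in_P] by blast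
  \<comment> \<open>The interval of ranks is nonempty, so its last value is attained, and the top
    has maximal rank.\<close>
  then have "r + int (length Ls) - 1 \<in> \<rho> ` P" using ranks by auto
  then have "r + int (length Ls) - 1 \<le> \<rho> top_elem" using rank_le_top by auto
  then show ?thesis using i by simp
qed

text \<open>The coatoms are the elements whose rank is one less than that of the top; with fewer
  than two levels there are none.\<close>

lemma distinct_coatom_level: "distinct (coatom_level Ls)"
  and set_coatom_level: "set (coatom_level Ls) = sorted_list_of_set ` coatoms P"
proof -
  have "distinct (coatom_level Ls) \<and> set (coatom_level Ls) = sorted_list_of_set ` coatoms P"
  proof (cases "length Ls < 2")
    case True
    have "coatoms P = {}"
    proof -
      have "\<rho> A \<noteq> \<rho> top_elem - 1" if "A \<in> P" for A
        using level_of[OF that] rank_top True by auto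
      then show ?thesis using coatoms_eq_rank by auto
    qed
    then show ?thesis using True by (simp add: coatom_level_def)
  next
    case False
    then have rank: "r + int (length Ls - 2) = \<rho> top_elem - 1" using rank_top by simp
    then show ?thesis
      using levels[of "length Ls - 2", unfolded rank] False
      unfolding coatoms_eq_rank coatom_level_def by simp
  qed
  then show "distinct (coatom_level Ls)"
    "set (coatom_level Ls) = sorted_list_of_set ` coatoms P" by simp_all
qed

lemma inj_sorted_list_coatoms: "inj_on sorted_list_of_set (coatoms P)"
  using inj_sorted_list by (rule inj_on_subset) (auto dest: coatom_in_P)

lemma length_coatom_level: "length (coatom_level Ls) = card (coatoms P)"
  using distinct_card[OF distinct_coatom_level] set_coatom_level
    card_image[OF inj_sorted_list_coatoms] by simp

lemma size_coatom_level:
  "(\<Sum>C\<leftarrow>coatom_level Ls. set_size C) = real (card (coatoms P)) + real alpha"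
proof -
  have "(\<Sum>C\<leftarrow>coatom_level Ls. set_size C) = (\<Sum>C\<in>sorted_list_of_set ` coatoms P. set_size C)"
    using sum_list_distinct_conv_sum_set[OF distinct_coatom_level] set_coatom_level by simp
  also have "\<dots> = (\<Sum>C\<in>coatoms P. 1 + real (card C))"
    using inj_sorted_list_coatoms by (simp add: sum.reindex set_size_def)
  finally show ?thesis by (simp add: sum.distrib)
qed

text \<open>Membership in consecutive levels supplies the rank hypothesis of
  \<open>covers_iff_coatom\<close>; injectivity of \<open>sorted_list_of_set\<close> on
  \<open>P\<close> translates lists back into sets.\<close>

lemma emitted_levels_eq:
  "emitted_levels (coatom_level Ls) Ls =
     {(sorted_list_of_set A, sorted_list_of_set B) |A B. covers P A B}"
  (is "?E = ?R")
proof (intro equalityI subsetI)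
  fix x assume "x \<in> ?E"
  then obtain a b i where x: "x = (a, b)" and i: "Suc i < length Ls"
      and b: "b \<in> set (Ls ! Suc i)" and e: "(a, b) \<in> emitted (Ls ! i) b (coatom_level Ls)"
    unfolding emitted_levels_def by auto
  obtain B where B: "b = sorted_list_of_set B" "B \<in> P" "\<rho> B = r + int (Suc i)"
    using b levels[OF i] by auto
  have "a \<in> set (Ls ! i)" and "a \<in> meet_list b ` set (coatom_level Ls)"
    using e unfolding emitted_def by auto
  then obtain A where A: "a = sorted_list_of_set A" "A \<in> P" "\<rho> A = r + int i"
    using levels[of i] i by auto
  obtain C where C: "C \<in> coatoms P" "a = meet_list b (sorted_list_of_set C)"
    using \<open>a \<in> meet_list b ` set (coatom_level Ls)\<close> set_coatom_level by auto
  have "a = sorted_list_of_set (B \<inter> C)"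
    using C B finite_elem coatom_in_P by (simp add: meet_list_def)
  then have "A = B \<inter> C"
    using A inj_onD[OF inj_sorted_list, of A "B \<inter> C"] Int_in_P[OF B(2) coatom_in_P[OF C(1)]]
    by simp
  then have "covers P A B"
    using covers_iff_coatom[of A B] A B C(1) by auto
  then show "x \<in> ?R" using x A(1) B(1) by auto
next
  fix x assume "x \<in> ?R"
  then obtain A B where x: "x = (sorted_list_of_set A, sorted_list_of_set B)" and cov: "covers P A B"
    by auto
  then have AB: "A \<in> P" "B \<in> P" "\<rho> B = \<rho> A + 1"
    using covers_rank[OF cov] by (simp_all add: covers_def)
  then obtain C where C: "C \<in> coatoms P" "A = B \<inter> C"
    using covers_iff_coatom[of A B] cov by auto
  obtain i where i: "i < length Ls" "\<rho> A = r + int i" using level_of[OF AB(1)] by auto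
  obtain j where j: "j < length Ls" "\<rho> B = r + int j" using level_of[OF AB(2)] by auto
  have ij: "j = Suc i" using i j AB(3) by simp
  have "sorted_list_of_set A \<in> set (Ls ! i)" "sorted_list_of_set B \<in> set (Ls ! Suc i)"
    using levels[of i] levels[of j] i j AB ij by auto
  moreover have "sorted_list_of_set A = meet_list (sorted_list_of_set B) (sorted_list_of_set C)"
    using C(2) finite_elem[OF AB(2)] finite_elem[OF coatom_in_P[OF C(1)]]
    by (simp add: meet_list_def)
  moreover have "sorted_list_of_set C \<in> set (coatom_level Ls)"
    using C(1) set_coatom_level by simp
  ultimately show "x \<in> ?E"
    using x i j ij unfolding emitted_levels_def emitted_def by auto
qed

end

text \<open>The maxima matter only if \<open>P\<close> has at most two elements; then \<open>\<alpha> = 0\<close>.\<close>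

abbreviation alpha' :: nat where
  "alpha' \<equiv> max 1 alpha"

abbreviation min_dim :: nat where
  "min_dim \<equiv> max 1 (min (card (coatoms P)) n)"

section \<open>Arithmetic of the time bound\<close>

lemma dims_le_alpha': "card (coatoms P) \<le> alpha'" "n \<le> alpha'"
  using sizes_le_alpha small_if_alpha_zero by (cases "alpha = 0"; force)+

text \<open>The factor \<open>2\<close> is for \<open>alpha = 0\<close>, where the left side is
  \<open>card P\<close>, at most \<open>2\<close>. Otherwise there are both atoms and coatoms, and
  the maxima on the left have no effect.\<close>

lemma size_product_le:
  "alpha' * min_dim * card P \<le> 2 * max 1 (alpha * min (card (coatoms P)) n * card P)"
proof (cases "alpha = 0")
  case True
  have "min_dim = 1" "card P \<le> 2" using small_if_alpha_zero[OF True] by simp_all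
  then show ?thesis unfolding True \<open>min_dim = 1\<close> by simp
next
  case False
  have "coatoms P \<noteq> {}" using False by auto
  then have "card (coatoms P) \<noteq> 0" using finite_coatoms by simp
  moreover have "n \<noteq> 0"
  proof
    assume "n = 0"
    then have "P \<subseteq> {{}}" using P_subset by simp
    then have "alpha = 0" using coatom_in_P by (intro sum.neutral) fastforce
    then show False using False by simp
  qed
  ultimately have eqs: "alpha' = alpha" "min_dim = min (card (coatoms P)) n"
    using False by simp_all
  show ?thesis unfolding eqs by linarith
qed

lemma lg_card_le: "lg (card P) \<le> 3 * real min_dim"
proof -
  let ?d = "min (card (coatoms P)) n"
  \<comment> \<open>The summand \<open>2\<close> inside \<open>lg\<close> is absorbed by the
    exponent \<open>?d + 2\<close>, which is at most three times the maximum of \<open>1\<close> and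
    \<open>?d\<close>.\<close>
  have "(1::nat) \<le> 2 ^ ?d" "(2::nat) ^ (?d + 2) = 4 * 2 ^ ?d" by simp_all
  then have "2 + card P \<le> 2 ^ (?d + 2)" using card_P_le by linarith
  then have "lg (card P) \<le> real (?d + 2)"
    using log2_of_power_le[of "2 + card P" "?d + 2"] by (simp add: lg_def)
  also have "\<dots> \<le> 3 * real min_dim" by simp
  finally show ?thesis .
qed

text \<open>Provides the bounds on \<open>W\<close> required by
  \<open>cover_relations_correct\<close>, with \<open>W = 92 * X\<close>. Here
  \<open>92 = 4 + 11 * 8\<close>, and the \<open>8\<close> collects one for \<open>m\<close>, one
  for \<open>m * n\<close> and six for the logarithmic term.\<close>

lemma level_costs:
  fixes K :: real
  assumes "1 \<le> K"
  defines "X \<equiv> K * real alpha' * real min_dim" and "m \<equiv> card (coatoms P)"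
  shows "4 * K + 11 * K * (real m * (1 + real n) + (real m + real alpha) * lg (card P)) \<le> 92 * X"
    and "3 + 2 * K * (1 + real n) * lg (card P) \<le> 92 * X"
    and "K \<le> X"
proof -
  define a M where aM_def: "a = real alpha'" "M = real min_dim"
  have am: "1 \<le> a" "1 \<le> M" "real m \<le> a" "real n \<le> a" "real alpha \<le> a"
    using dims_le_alpha' unfolding m_def aM_def by (simp_all del: of_nat_sum)
  have aM: "a \<le> a * M" using am mult_left_mono[of 1 M a] by simp
  \<comment> \<open>Both \<open>m\<close> and \<open>n\<close> are at most \<open>alpha'\<close>, so
    the larger is bounded by \<open>alpha'\<close> and the smaller by
    \<open>min_dim\<close>.\<close>
  have "m * n = max m n * min m n" by (simp add: max_def min_def)
  also have "\<dots> \<le> alpha' * min_dim"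
    using dims_le_alpha' by (intro mult_mono) (auto simp: m_def)
  finally have mn: "real m * real n \<le> a * M"
    unfolding aM_def by (metis of_nat_le_iff of_nat_mult)
  have lg: "0 \<le> lg (card P)" "lg (card P) \<le> 3 * M"
    using lg_ge_1[of "card P"] lg_card_le unfolding aM_def by simp_all
  have l1: "(real m + real alpha) * lg (card P) \<le> (2 * a) * (3 * M)"
    using am lg by (intro mult_mono) auto
  have l2: "(1 + real n) * lg (card P) \<le> (2 * a) * (3 * M)"
    using am lg by (intro mult_mono) auto
  have X: "X = K * (a * M)" by (simp only: X_def aM_def mult.assoc)
  show KX: "K \<le> X"
    unfolding X using mult_left_mono[of 1 "a * M" K] aM am(1) assms(1) by linarith
  have "real m * (1 + real n) + (real m + real alpha) * lg (card P) \<le> 8 * (a * M)"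
    using mn l1 aM am(3) by (simp add: distrib_left)
  then have "K * (real m * (1 + real n) + (real m + real alpha) * lg (card P)) \<le> K * (8 * (a * M))"
    using assms(1) by (intro mult_left_mono) auto
  then show "4 * K + 11 * K * (real m * (1 + real n) + (real m + real alpha) * lg (card P)) \<le> 92 * X"
    using KX X by (simp add: mult.assoc)
  have "K * ((1 + real n) * lg (card P)) \<le> K * ((2 * a) * (3 * M))"
    using assms(1) l2 by (intro mult_left_mono) auto
  also have "\<dots> = 6 * X" unfolding X by simp
  finally show "3 + 2 * K * (1 + real n) * lg (card P) \<le> 92 * X"
    using KX assms(1) unfolding mult.assoc by linarith
qed

lemma cover_relations_time:
  assumes cost: "bounded_cost T K" and "level_lists P \<rho> Ls"
  shows "\<exists>s. exec T cover_relations (initial_state Ls) = Some s \<and> generates_covers P s \<and>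
    time s \<le> 394 * K * real (max 1 (alpha * min (card (coatoms P)) n * card P))"
proof -
  interpret bounded_cost T K by (rule cost)
  obtain r where r: "\<rho> ` P = {r..<r + int (length Ls)}"
      "\<forall>i<length Ls. distinct (Ls ! i) \<and>
          set (Ls ! i) = sorted_list_of_set ` {A\<in>P. \<rho> A = r + int i}"
    using assms(2) unfolding level_lists_def by blast
  define X where "X = K * real alpha' * real min_dim"
  have size: "set_size A \<le> 1 + real n" if mem: "A \<in> set (concat Ls)" for A
  proof -
    obtain B where "B \<in> P" "A = sorted_list_of_set B"
      using mem unfolding set_concat_levels[OF r] by auto
    moreover have "card B \<le> card {1..n}"
      using P_subset \<open>B \<in> P\<close> by (intro card_mono) auto
    ultimately show ?thesis by (simp add: set_size_def)
  qed
  have ne: "[] \<notin> set Ls" using level_nonempty[OF r] by (metis in_set_conv_nth)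
  obtain s where s: "exec T cover_relations (initial_state Ls) = Some s" "distinct (out s)"
      "set (out s) = emitted_levels (coatom_level Ls) Ls"
      "time s \<le> 8 * K + 5 * K * real (length Ls) + 2 * (92 * X) * real (length (concat Ls))"
  proof -
    have "\<exists>s. exec T cover_relations (initial_state Ls) = Some s \<and> distinct (out s) \<and>
        set (out s) = emitted_levels (coatom_level Ls) Ls \<and>
        time s \<le> 8 * K + 5 * K * real (length Ls) + 2 * (92 * X) * real (length (concat Ls))"
      using distinct_concat_levels[OF r] ne size length_level_le[OF r] level_costs(1,2)[OF K_ge_1]
      unfolding X_def
      by (intro cover_relations_correct[where a = "1 + real n" and N = "card P"])
        (simp_all only: length_coatom_level[OF r] size_coatom_level[OF r] not_False_eq_True)
    then show thesis using that by blast
  qed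
  have KX: "K \<le> X" using level_costs[OF K_ge_1] by (simp add: X_def)
  have \<phi>: "1 \<le> real (card P)"
    using finite_P P_nonempty by (simp add: Suc_le_eq card_gt_0_iff)
  have "K \<le> X * real (card P)" using KX \<phi> K_ge_1 mult_mono[of K X 1 "real (card P)"] by simp
  moreover have "K * real (length Ls) \<le> X * real (card P)"
    using KX K_ge_1 number_of_levels_le[OF r] by (intro mult_mono) auto
  \<comment> \<open>\<open>197 = 8 + 5 + 2 * 92\<close>; the factor \<open>2\<close> of
    \<open>size_product_le\<close> later turns it into \<open>394\<close>.\<close>
  ultimately have "time s \<le> 197 * (X * real (card P))"
    using s(4) length_concat_levels[OF r] by simp
  also have "X * real (card P) = K * real (alpha' * min_dim * card P)"
    unfolding X_def of_nat_mult by (simp only: mult.assoc)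
  also have "\<dots> \<le> K * real (2 * max 1 (alpha * min (card (coatoms P)) n * card P))"
  proof (rule mult_left_mono)
    show "real (alpha' * min_dim * card P)
        \<le> real (2 * max 1 (alpha * min (card (coatoms P)) n * card P))"
      using size_product_le by (simp only: of_nat_le_iff)
  qed (use K_ge_1 in simp)
  finally have "time s \<le> 394 * K * real (max 1 (alpha * min (card (coatoms P)) n * card P))"
    by simp
  then show ?thesis
    using s(1-3) emitted_levels_eq[OF r] unfolding generates_covers_def by auto
qed

end

lemma time_bound_nonneg: "0 \<le> time_bound f vs"
proof -
  have "0 \<le> fam_size D" for D
    unfolding fam_size_def set_size_def by (intro add_nonneg_nonneg sum_list_nonneg) auto
  moreover have "0 \<le> max_size D" for D
  proof -
    have "1 \<le> max_size D" by (simp add: max_size_def)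
    then show ?thesis by simp
  qed
  moreover have "0 \<le> lg k" for k using lg_ge_1[of k] by simp
  moreover have "0 \<le> set_size A" for A by (simp add: set_size_def)
  ultimately show ?thesis
    by (cases f) (simp_all split: list.split val.split add: le_max_iff_disj)
qed

text \<open>Since the bounds are nonnegative, the constant may be raised to at least
  \<open>1\<close>; unit steps are then absorbed into multiples of it.\<close>

lemma bounded_cost_exists:
  assumes "cost_model T"
  shows "\<exists>K. bounded_cost T K"
proof -
  obtain K where K: "\<And>f vs. T f vs \<le> K * time_bound f vs"
    using assms unfolding cost_model_def by blast
  have "T f vs \<le> max 1 K * time_bound f vs" for f vs
    using K[of f vs] mult_right_mono[OF max.cobounded2[of K 1] time_bound_nonneg[of f vs]]
    by linarith
  then show ?thesis by (intro exI[of _ "max 1 K"]) (simp add: bounded_cost_def)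
qed

text \<open>The maximum with \<open>1\<close> accounts for lattices with \<open>alpha = 0\<close>,
  for which the product vanishes although running the program takes positive time.\<close>

theorem proposition4p2:
  shows "\<exists>c :: prog. \<forall>T. cost_model T \<longrightarrow>
    (\<exists>C :: real. \<forall>(n :: nat) (P :: nat set set) (\<rho> :: nat set \<Rightarrow> int) (Ls :: nat list list list).
      meet_subsemilattice n P \<and> locally_branched P \<and> rank_function P \<rho> \<and> level_lists P \<rho> Ls \<longrightarrow>
      (\<exists>s. exec T c (initial_state Ls) = Some s \<and> generates_covers P s \<and>
        time s \<le> C * real (max 1 ((\<Sum>A\<in>coatoms P. card A) * min (card (coatoms P)) n * card P))))"
proof (intro exI[of _ cover_relations] allI impI)
  fix T assume "cost_model T"
  then obtain K where "bounded_cost T K" using bounded_cost_exists by blast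
  then show "\<exists>C :: real. \<forall>(n :: nat) (P :: nat set set) (\<rho> :: nat set \<Rightarrow> int) (Ls :: nat list list list).
      meet_subsemilattice n P \<and> locally_branched P \<and> rank_function P \<rho> \<and> level_lists P \<rho> Ls \<longrightarrow>
      (\<exists>s. exec T cover_relations (initial_state Ls) = Some s \<and> generates_covers P s \<and>
        time s \<le> C * real (max 1 ((\<Sum>A\<in>coatoms P. card A) * min (card (coatoms P)) n * card P)))"
    using graded_branched.cover_relations_time graded_branched.intro
    by (intro exI[of _ "394 * K"]) metis
qed

end
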